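(* For every positive integer $n$ and any two sets $A,B \subseteq \{0,1\}^n$ with $|A|=|B|=2^{n-1}$, there exists a bijection $\phi \colon A \to B$ such that $\mathbb{E}_{x \in A}[\mathrm{dist}(x,\phi(x))] \le \sqrt{2n}$, where $x$ is uniform in $A$.
   Context: $\mathrm{dist}$ denotes the Hamming distance on $\{0,1\}^n$. *)

theory Defs
  imports "HOL-Probability.Probability"
begin

definition cube :: "nat \<Rightarrow> bool list set" where
  "cube n = {xs. length xs = n}"

(* Only meant for lists of equal length: positions beyond the first list are ignored. *)
definition hamming_dist :: "'a list \<Rightarrow> 'a list \<Rightarrow> nat" where
  "hamming_dist xs ys = card {i. i < length xs \<and> xs ! i \<noteq> ys ! i}"

end

theory Submission
  imports Defs
begin

text \<open>
  By integral duality for the assignment problem (a maximal integer dual solution has, by Hall's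
  theorem, a perfect matching among its tight edges), some bijection \<open>\<phi>\<close> and some function \<open>f\<close>
  on the cube that is 1-Lipschitz for the Hamming distance satisfy
  \<open>(\<Sum>x\<in>A. dist x (\<phi> x)) \<le> (\<Sum>x\<in>A. f x) - (\<Sum>y\<in>B. f y)\<close>. A 1-Lipschitz function on the cube has
  variance at most \<open>n/4\<close>, so by Cauchy-Schwarz the right-hand side is at most
  \<open>2 ^ n * sqrt n / 2\<close>. The resulting bound on the expectation is \<open>sqrt n\<close>.
\<close>

section \<open>Hall's theorem and integral assignment duality\<close>

text \<open>Halmos-Vaughan induction on \<open>card A\<close>. If some proper nonempty
  \<open>S\<close> has no surplus of neighbours, \<open>S\<close> and \<open>A - S\<close> are
  matched separately, the latter avoiding the neighbours of \<open>S\<close>. Otherwise every proper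
  nonempty subset has a surplus, and one element may be matched arbitrarily.\<close>

theorem hall_marriage:
  fixes N :: "'a \<Rightarrow> 'b set"
  assumes "finite A" "\<And>x. x \<in> A \<Longrightarrow> finite (N x)"
    and "\<And>S. S \<subseteq> A \<Longrightarrow> card S \<le> card (\<Union>(N ` S))"
  shows "\<exists>f. inj_on f A \<and> (\<forall>x\<in>A. f x \<in> N x)"
  using assms
proof (induction "card A" arbitrary: A N rule: less_induct)
  case less
  note fin = less.prems(1) and finN = less.prems(2) and hall = less.prems(3)
  have finU: "finite (\<Union>(N ` S))" if "S \<subseteq> A" for S
    using that fin finN by (meson finite_UN finite_subset subsetD)
  show ?case
  proof (cases "\<exists>S. S \<subset> A \<and> S \<noteq> {} \<and> card (\<Union>(N ` S)) \<le> card S")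
    case True
    then obtain S where S: "S \<subset> A" "S \<noteq> {}" "card (\<Union>(N ` S)) \<le> card S" by blast
    have finS: "finite S" using S(1) fin by (meson finite_subset psubsetE)
    define N' where "N' = (\<lambda>x. N x - \<Union>(N ` S))"
    have lt1: "card S < card A" using S(1) fin by (rule psubset_card_mono[rotated])
    have lt2: "card (A - S) < card A"
      using S fin by (intro psubset_card_mono) auto
    have "finite (N x)" if "x \<in> S" for x
      using that S(1) finN by blast
    moreover have "card T \<le> card (\<Union>(N ` T))" if "T \<subseteq> S" for T
      using that S(1) by (intro hall) blast
    ultimately obtain f where f: "inj_on f S" "\<forall>x\<in>S. f x \<in> N x"
      using less.hyps[OF lt1 finS, of N] by blast
    \<comment> \<open>Hall's condition for \<open>T \<union> S\<close> leaves enough neighbours for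
      \<open>T\<close>, since those of \<open>S\<close> number at most
      \<open>card S\<close>.\<close>
    have hall': "card T \<le> card (\<Union>(N' ` T))" if T: "T \<subseteq> A - S" for T
    proof -
      have finT: "finite T" using T fin by (meson Diff_subset finite_subset subset_trans)
      have "card T + card S = card (T \<union> S)"
        using T by (intro card_Un_disjoint[symmetric] finT finS) auto
      also have "\<dots> \<le> card (\<Union>(N ` (T \<union> S)))"
        using T S(1) by (intro hall) auto
      also have "\<Union>(N ` (T \<union> S)) = \<Union>(N' ` T) \<union> \<Union>(N ` S)"
        by (auto simp: N'_def)
      also have "card \<dots> \<le> card (\<Union>(N' ` T)) + card (\<Union>(N ` S))"
        by (rule card_Un_le)
      finally show ?thesis using S(3) by simp
    qed
    have "finite (N' x)" if "x \<in> A - S" for x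
      using that finN by (auto simp: N'_def)
    then obtain g where g: "inj_on g (A - S)" "\<forall>x\<in>A - S. g x \<in> N' x"
      using less.hyps[OF lt2 finite_Diff[OF fin], of N'] hall' by blast
    have "inj_on (\<lambda>x. if x \<in> S then f x else g x) A"
    proof (rule inj_onI)
      fix x y assume xy: "x \<in> A" "y \<in> A"
        and eq: "(if x \<in> S then f x else g x) = (if y \<in> S then f y else g y)"
      have "f a \<noteq> g b" if "a \<in> S" "b \<in> A - S" for a b
        using f(2) g(2) that by (force simp: N'_def)
      note sep = this
      show "x = y"
      proof (cases "x \<in> S"; cases "y \<in> S")
        assume "x \<in> S" "y \<in> S"
        then show ?thesis using eq f(1) by (simp add: inj_on_eq_iff)
      next
        assume "x \<notin> S" "y \<notin> S"
        then show ?thesis using eq g(1) xy by (simp add: inj_on_eq_iff)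
      qed (use sep[of x y] sep[of y x] eq xy in auto)
    qed
    moreover have "(if x \<in> S then f x else g x) \<in> N x" if "x \<in> A" for x
      using that f(2) g(2) by (auto simp: N'_def)
    ultimately show ?thesis
      by (intro exI[of _ "\<lambda>x. if x \<in> S then f x else g x"]) blast
  next
    case False
    show ?thesis
    proof (cases "A = {}")
      case False
      then obtain a where a: "a \<in> A" by blast
      have "card {a} \<le> card (\<Union>(N ` {a}))" using a by (intro hall) auto
      then obtain b where b: "b \<in> N a" by fastforce
      define N' where "N' = (\<lambda>x. N x - {b})"
      have lt: "card (A - {a}) < card A" using a fin by (meson card_Diff1_less)
      have hall': "card T \<le> card (\<Union>(N' ` T))" if T: "T \<subseteq> A - {a}" for T
      proof (cases "T = {}")
        case False
        have "T \<subset> A" using T a by blast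
        \<comment> \<open>The strict surplus of \<open>T\<close> pays for the loss of the single
          point \<open>b\<close>.\<close>
        with False \<open>\<nexists>S. S \<subset> A \<and> S \<noteq> {} \<and> card (\<Union>(N ` S)) \<le> card S\<close>
        have "card T < card (\<Union>(N ` T))" by (meson linorder_not_le)
        moreover have "\<Union>(N' ` T) = \<Union>(N ` T) - {b}" by (auto simp: N'_def)
        moreover have "card (\<Union>(N ` T)) - 1 \<le> card (\<Union>(N ` T) - {b})"
          by (simp add: card_Diff_singleton_if)
        ultimately show ?thesis by simp
      qed simp
      have "finite (N' x)" if "x \<in> A - {a}" for x
        using that finN by (auto simp: N'_def)
      then obtain g where g: "inj_on g (A - {a})" "\<forall>x\<in>A - {a}. g x \<in> N' x"
        using less.hyps[OF lt finite_Diff[OF fin], of N'] hall' by blast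
      have "inj_on (g(a := b)) A"
        using g by (auto simp: inj_on_def N'_def)
      moreover have "\<forall>x\<in>A. (g(a := b)) x \<in> N x"
        using g(2) b by (auto simp: N'_def)
      ultimately show ?thesis by blast
    qed simp
  qed
qed

text \<open>The last two conclusions are dual feasibility and complementary slackness, which certify
  that \<open>\<phi>\<close> has minimal total cost.\<close>

lemma integral_assignment_duality:
  fixes c :: "'a \<Rightarrow> 'b \<Rightarrow> int"
  assumes A: "finite A" and B: "finite B" and card: "card A = card B"
  obtains \<phi> u v where "bij_betw \<phi> A B"
    and "\<And>x y. x \<in> A \<Longrightarrow> y \<in> B \<Longrightarrow> u x + v y \<le> c x y"
    and "\<And>x. x \<in> A \<Longrightarrow> u x + v (\<phi> x) = c x (\<phi> x)"
proof -
  define feas where "feas = (\<lambda>(u :: 'a \<Rightarrow> int, v :: 'b \<Rightarrow> int). \<forall>x\<in>A. \<forall>y\<in>B. u x + v y \<le> c x y)"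
  define obj where "obj = (\<lambda>(u :: 'a \<Rightarrow> int, v :: 'b \<Rightarrow> int). sum u A + sum v B)"
  obtain g where g: "bij_betw g A B" using finite_same_card_bij[OF A B card] by blast
  \<comment> \<open>Weak duality: the cost of any one bijection bounds the dual objective from
    above.\<close>
  define K where "K = (\<Sum>x\<in>A. c x (g x))"
  have bound: "obj p \<le> K" if "feas p" for p
  proof -
    obtain u v where p: "p = (u, v)" by (cases p)
    have "obj p = (\<Sum>x\<in>A. u x + v (g x))"
      using sum.reindex_bij_betw[OF g, of v] by (simp add: obj_def p sum.distrib)
    also have "\<dots> \<le> K"
      unfolding K_def using that bij_betwE[OF g] by (intro sum_mono) (auto simp: feas_def p)
    finally show ?thesis .
  qed
  have "feas (\<lambda>x. - (\<Sum>y\<in>B. \<bar>c x y\<bar>), \<lambda>_. 0)"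
    unfolding feas_def
  proof (clarsimp)
    fix x y assume "y \<in> B"
    then have "\<bar>c x y\<bar> \<le> (\<Sum>y\<in>B. \<bar>c x y\<bar>)"
      using B by (intro member_le_sum) auto
    then show "- (\<Sum>y\<in>B. \<bar>c x y\<bar>) \<le> c x y" by linarith
  qed
  \<comment> \<open>Maximising \<open>obj\<close> becomes minimising a natural number;
    \<open>nat\<close> truncates nothing on feasible pairs, where \<open>obj\<close> is at most
    \<open>K\<close>.\<close>
  from ex_has_least_nat[of feas, OF this, of "\<lambda>p. nat (K - obj p)"]
  obtain p where p: "feas p" and least: "\<And>q. feas q \<Longrightarrow> nat (K - obj p) \<le> nat (K - obj q)" by blast
  have max: "obj q \<le> obj p" if "feas q" for q
    using least[OF that] bound[OF that] bound[OF p] by linarith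
  obtain u v where uv: "p = (u, v)" by (cases p)
  have feas: "u x + v y \<le> c x y" if "x \<in> A" "y \<in> B" for x y
    using p that by (auto simp: feas_def uv)
  define N where "N = (\<lambda>x. {y\<in>B. u x + v y = c x y})"
  have hall: "card S \<le> card (\<Union>(N ` S))" if S: "S \<subseteq> A" for S
  proof -
    \<comment> \<open>Raising \<open>u\<close> by 1 on \<open>S\<close> and lowering \<open>v\<close> by 1 on the tight neighbourhood of \<open>S\<close> stays
      feasible because slacks are integers.\<close>
    define T where "T = \<Union>(N ` S)"
    have TB: "T \<subseteq> B" by (auto simp: T_def N_def)
    define u' where "u' = (\<lambda>x. u x + (if x \<in> S then 1 else 0))"
    define v' where "v' = (\<lambda>y. v y - (if y \<in> T then 1 else 0))"
    have "u' x + v' y \<le> c x y" if "x \<in> A" "y \<in> B" for x y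
    proof (cases "x \<in> S \<and> y \<notin> T")
      case True
      then have "u x + v y \<noteq> c x y" using that by (auto simp: T_def N_def)
      then show ?thesis using feas[OF that] True by (simp add: u'_def v'_def)
    qed (use feas[OF that] in \<open>auto simp: u'_def v'_def\<close>)
    \<comment> \<open>The shift changes the objective by \<open>card S - card T\<close>, so
      maximality of \<open>p\<close> forces Hall's condition.\<close>
    then have "obj (u', v') \<le> obj p" by (intro max) (auto simp: feas_def)
    moreover have "sum u' A = sum u A + int (card S)"
      using A S by (simp add: u'_def sum.distrib sum.If_cases Int_absorb1)
    moreover have "sum v' B = sum v B - int (card T)"
      using B TB by (simp add: v'_def sum_subtractf sum.If_cases Int_absorb1)
    ultimately show ?thesis by (simp add: obj_def uv T_def)
  qed
  have "finite (N x)" for x using B by (simp add: N_def)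
  from hall_marriage[OF A this hall]
  obtain \<phi> where \<phi>: "inj_on \<phi> A" "\<forall>x\<in>A. \<phi> x \<in> N x" by blast
  have "\<phi> ` A \<subseteq> B" using \<phi>(2) by (auto simp: N_def)
  with \<phi>(1) B card have "bij_betw \<phi> A B"
    by (metis bij_betw_def card_image card_subset_eq)
  moreover have "u x + v (\<phi> x) = c x (\<phi> x)" if "x \<in> A" for x
    using \<phi>(2) that by (auto simp: N_def)
  ultimately show thesis using feas that by blast
qed

section \<open>Lipschitz functions on the Hamming cube\<close>

lemma hamming_dist_Cons:
  "hamming_dist (a # xs) (b # ys) = (if a = b then 0 else 1) + hamming_dist xs ys"
proof -
  have "{i. i < length (a # xs) \<and> (a # xs) ! i \<noteq> (b # ys) ! i} =
    (if a = b then {} else {0}) \<union> Suc ` {i. i < length xs \<and> xs ! i \<noteq> ys ! i}"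
    (is "?L = _ \<union> ?R")
  proof (rule set_eqI)
    show "i \<in> ?L \<longleftrightarrow> i \<in> (if a = b then {} else {0}) \<union> ?R" for i
      by (cases i) auto
  qed
  moreover have "card ((if a = b then {} else {0}) \<union> ?R) = card (if a = b then {} else {0::nat}) + card ?R"
    by (intro card_Un_disjoint) auto
  ultimately show ?thesis by (simp add: hamming_dist_def card_image)
qed

lemma hamming_dist_refl [simp]: "hamming_dist xs xs = 0"
  by (simp add: hamming_dist_def)

text \<open>If \<open>xs\<close> and \<open>zs\<close> differ at a position, then \<open>ys\<close>
  differs there from one of them; equal lengths ensure that \<open>hamming_dist ys zs\<close>
  inspects that position.\<close>

lemma hamming_dist_triangle:
  assumes "length xs = length ys"
  shows "hamming_dist xs zs \<le> hamming_dist xs ys + hamming_dist ys zs"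
proof -
  have "hamming_dist xs zs \<le> card ({i. i < length xs \<and> xs ! i \<noteq> ys ! i} \<union> {i. i < length ys \<and> ys ! i \<noteq> zs ! i})"
    unfolding hamming_dist_def using assms by (intro card_mono) auto
  also have "\<dots> \<le> hamming_dist xs ys + hamming_dist ys zs"
    unfolding hamming_dist_def by (rule card_Un_le)
  finally show ?thesis .
qed

lemma finite_cube [simp]: "finite (cube n)"
  using finite_lists_length_eq[of "UNIV :: bool set" n] by (simp add: cube_def)

lemma card_cube: "card (cube n) = 2 ^ n"
  using card_lists_length_eq[of "UNIV :: bool set" n] by (simp add: cube_def)

lemma sum_cube_Suc:
  "sum f (cube (Suc n)) = (\<Sum>x\<in>cube n. f (True # x)) + (\<Sum>x\<in>cube n. f (False # x))"
proof -
  have "cube (Suc n) = (#) True ` cube n \<union> (#) False ` cube n"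
    by (auto simp: cube_def length_Suc_conv)
  then have "sum f (cube (Suc n)) = sum f ((#) True ` cube n) + sum f ((#) False ` cube n)"
    by (simp only:) (rule sum.union_disjoint; auto)
  then show ?thesis by (simp add: sum.reindex)
qed

text \<open>The left-hand side is \<open>4 ^ n\<close> times the variance of \<open>f\<close>.\<close>

lemma lipschitz_cube_variance:
  fixes f :: "bool list \<Rightarrow> real"
  assumes "\<And>x y. x \<in> cube n \<Longrightarrow> y \<in> cube n \<Longrightarrow> f x - f y \<le> hamming_dist x y"
  shows "2 ^ n * (\<Sum>x\<in>cube n. (f x)\<^sup>2) - (\<Sum>x\<in>cube n. f x)\<^sup>2 \<le> 4 ^ n * real n / 4"
  using assms
proof (induction n arbitrary: f)
  case 0
  have "cube 0 = {[]}" by (auto simp: cube_def)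
  then show ?case by simp
next
  case (Suc n)
  define S where "S = (\<lambda>b. \<Sum>x\<in>cube n. f (b # x))"
  define Q where "Q = (\<lambda>b. \<Sum>x\<in>cube n. (f (b # x))\<^sup>2)"
  have IH: "2 ^ n * Q b - (S b)\<^sup>2 \<le> 4 ^ n * real n / 4" for b
    unfolding Q_def S_def
  proof (rule Suc.IH)
    fix x y assume "x \<in> cube n" "y \<in> cube n"
    then show "f (b # x) - f (b # y) \<le> hamming_dist x y"
      using Suc.prems[of "b # x" "b # y"] by (simp add: cube_def hamming_dist_Cons)
  qed
  \<comment> \<open>Flipping the first coordinate moves \<open>f\<close> by at most 1 at each of the
    \<open>2 ^ n\<close> points of a half.\<close>
  have "S b - S (\<not> b) \<le> 2 ^ n" for b
  proof -
    have "S b - S (\<not> b) \<le> (\<Sum>x\<in>cube n. 1)"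
      unfolding S_def sum_subtractf[symmetric]
    proof (rule sum_mono)
      fix x assume "x \<in> cube n"
      then show "f (b # x) - f ((\<not> b) # x) \<le> 1"
        using Suc.prems[of "b # x" "(\<not> b) # x"] by (simp add: cube_def hamming_dist_Cons)
    qed
    then show ?thesis by (simp add: card_cube)
  qed
  from this[of True] this[of False] have "\<bar>S True - S False\<bar> \<le> 2 ^ n" by simp
  then have "(S True - S False)\<^sup>2 \<le> (2 ^ n)\<^sup>2"
    by (metis abs_ge_zero power2_abs power_mono)
  then have sq: "(S True - S False)\<^sup>2 \<le> 4 ^ n"
    by (simp add: power2_eq_square flip: power_mult_distrib)
  \<comment> \<open>Law of total variance for the first coordinate: variance within the two halves
    plus the squared gap between them.\<close>
  have "2 ^ Suc n * (Q True + Q False) - (S True + S False)\<^sup>2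
      = 2 * (2 ^ n * Q True - (S True)\<^sup>2) + 2 * (2 ^ n * Q False - (S False)\<^sup>2) + (S True - S False)\<^sup>2"
    by (simp add: power2_eq_square algebra_simps)
  also have "\<dots> \<le> 2 * (4 ^ n * real n / 4) + 2 * (4 ^ n * real n / 4) + 4 ^ n"
    by (intro add_mono mult_left_mono IH sq) auto
  also have "\<dots> = 4 ^ Suc n * real (Suc n) / 4"
    by (simp add: algebra_simps)
  finally show ?case by (simp add: sum_cube_Suc Q_def S_def)
qed

text \<open>The difference of sums is the inner product of \<open>f\<close> with \<open>h\<close>,
  the difference of the indicators. As \<open>h\<close> sums to zero, \<open>f\<close> can be
  centred at its mean before Cauchy-Schwarz brings in the variance.\<close>

lemma lipschitz_cube_sum_diff:
  fixes f :: "bool list \<Rightarrow> real"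
  assumes lip: "\<And>x y. x \<in> cube n \<Longrightarrow> y \<in> cube n \<Longrightarrow> f x - f y \<le> hamming_dist x y"
    and A: "A \<subseteq> cube n" and B: "B \<subseteq> cube n" and card: "card A = card B"
  shows "sum f A - sum f B \<le> 2 ^ n * sqrt n / 2"
proof -
  define m where "m = (\<Sum>x\<in>cube n. f x) / 2 ^ n"
  define h :: "bool list \<Rightarrow> real" where "h = (\<lambda>x. indicator A x - indicator B x)"
  have "(\<Sum>x\<in>cube n. (f x - m)\<^sup>2) = (\<Sum>x\<in>cube n. (f x)\<^sup>2) - 2 * m * (\<Sum>x\<in>cube n. f x) + 2 ^ n * m\<^sup>2"
    by (simp add: power2_diff sum.distrib sum_subtractf sum_distrib_left card_cube mult_ac)
  also have "\<dots> = (2 ^ n * (\<Sum>x\<in>cube n. (f x)\<^sup>2) - (\<Sum>x\<in>cube n. f x)\<^sup>2) / 2 ^ n"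
    by (simp add: m_def field_simps power2_eq_square)
  also have "\<dots> \<le> (4 ^ n * real n / 4) / 2 ^ n"
    using lipschitz_cube_variance[OF lip] by (intro divide_right_mono) auto
  also have "\<dots> = 2 ^ n * real n / 4"
    by (simp add: field_simps flip: power_mult_distrib)
  finally have var: "(\<Sum>x\<in>cube n. (f x - m)\<^sup>2) \<le> 2 ^ n * real n / 4" .
  \<comment> \<open>\<open>h\<close> takes only the values -1, 0 and 1, however \<open>A\<close> and
    \<open>B\<close> overlap.\<close>
  have "(\<Sum>x\<in>cube n. (h x)\<^sup>2) \<le> (\<Sum>x\<in>cube n. 1)"
    by (intro sum_mono) (auto simp: h_def indicator_def)
  then have h2: "(\<Sum>x\<in>cube n. (h x)\<^sup>2) \<le> 2 ^ n" by (simp add: card_cube)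
  have ind: "(\<Sum>x\<in>cube n. g x * indicator C x) = sum g C" if "C \<subseteq> cube n"
    for g :: "bool list \<Rightarrow> real" and C
    using that by (simp add: sum.inter_restrict[symmetric] indicator_def if_distrib Int_absorb1 cong: if_cong)
  have "sum f A - sum f B = (\<Sum>x\<in>A. f x - m) - (\<Sum>x\<in>B. f x - m)"
    using card by (simp add: sum_subtractf)
  also have "\<dots> = (\<Sum>x\<in>cube n. (f x - m) * h x)"
    unfolding h_def right_diff_distrib sum_subtractf[of "\<lambda>x. (f x - m) * indicator A x"]
      ind[OF A] ind[OF B] by simp
  finally have "(sum f A - sum f B)\<^sup>2 = (\<Sum>x\<in>cube n. (f x - m) * h x)\<^sup>2" by simp
  also have "\<dots> \<le> (\<Sum>x\<in>cube n. (f x - m)\<^sup>2) * (\<Sum>x\<in>cube n. (h x)\<^sup>2)"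
    by (rule Cauchy_Schwarz_ineq_sum)
  also have "\<dots> \<le> (2 ^ n * real n / 4) * 2 ^ n"
    using var h2 by (intro mult_mono) (auto intro: sum_nonneg)
  also have "\<dots> = (2 ^ n * sqrt n / 2)\<^sup>2"
    by (simp add: power_mult_distrib power_divide) (simp add: power2_eq_square)
  finally show ?thesis by (rule power2_le_imp_le) simp
qed

text \<open>Kantorovich-Rubinstein duality: because the cost is a metric on the cube, the two dual
  functions \<open>u\<close> and \<open>v\<close> can be replaced by a single 1-Lipschitz potential
  without lowering the dual value.\<close>

lemma hamming_bijection_lipschitz_potential:
  assumes A: "A \<subseteq> cube n" and B: "B \<subseteq> cube n" and card: "card A = card B" and "B \<noteq> {}"
  obtains \<phi> and f :: "bool list \<Rightarrow> real" where "bij_betw \<phi> A B"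
    and "\<And>x y. x \<in> cube n \<Longrightarrow> y \<in> cube n \<Longrightarrow> f x - f y \<le> hamming_dist x y"
    and "(\<Sum>x\<in>A. real (hamming_dist x (\<phi> x))) \<le> sum f A - sum f B"
proof -
  have finA: "finite A" and finB: "finite B" using A B by (auto intro: finite_subset)
  obtain \<phi> u v where \<phi>: "bij_betw \<phi> A B"
    and feas: "\<And>x y. x \<in> A \<Longrightarrow> y \<in> B \<Longrightarrow> u x + v y \<le> int (hamming_dist x y)"
    and tight: "\<And>x. x \<in> A \<Longrightarrow> u x + v (\<phi> x) = int (hamming_dist x (\<phi> x))"
    using integral_assignment_duality[OF finA finB card, of "\<lambda>x y. int (hamming_dist x y)"] by blast
  \<comment> \<open>The c-transform of \<open>v\<close>: the largest function compatible with
    \<open>v\<close> in the dual constraints, and 1-Lipschitz as a minimum of shifted distance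
    functions.\<close>
  define f where "f = (\<lambda>z. Min ((\<lambda>y. int (hamming_dist z y) - v y) ` B))"
  have f_le: "f z \<le> int (hamming_dist z y) - v y" if "y \<in> B" for z y
    using that finB by (simp add: f_def)
  have f_ge: "k \<le> f z" if "\<And>y. y \<in> B \<Longrightarrow> k \<le> int (hamming_dist z y) - v y" for k z
    using that finB \<open>B \<noteq> {}\<close> by (simp add: f_def)
  have lip: "f x - f y \<le> int (hamming_dist x y)" if "x \<in> cube n" "y \<in> cube n" for x y
  proof -
    have "f x - int (hamming_dist x y) \<le> f y"
    proof (rule f_ge)
      fix w assume "w \<in> B"
      then show "f x - int (hamming_dist x y) \<le> int (hamming_dist y w) - v w"
        using f_le[of w x] hamming_dist_triangle[of x y w] that by (simp add: cube_def)
    qed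
    then show ?thesis by simp
  qed
  have "(\<Sum>x\<in>A. int (hamming_dist x (\<phi> x))) = (\<Sum>x\<in>A. u x + v (\<phi> x))"
    by (intro sum.cong) (simp_all add: tight)
  also have "\<dots> = sum u A + sum v B"
    using sum.reindex_bij_betw[OF \<phi>, of v] by (simp add: sum.distrib)
  also have "\<dots> \<le> sum f A + (\<Sum>y\<in>B. - f y)"
  proof (intro add_mono sum_mono)
    show "u x \<le> f x" if "x \<in> A" for x
      using feas that by (intro f_ge) force
    \<comment> \<open>The point \<open>y\<close> itself competes in the minimum defining
      \<open>f y\<close>, at distance 0.\<close>
    show "v y \<le> - f y" if "y \<in> B" for y
      using f_le[OF that, of y] by simp
  qed
  finally have "(\<Sum>x\<in>A. int (hamming_dist x (\<phi> x))) \<le> sum f A - sum f B"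
    by (simp add: sum_negf)
  then have "real_of_int (\<Sum>x\<in>A. int (hamming_dist x (\<phi> x))) \<le> real_of_int (sum f A - sum f B)"
    by (simp only: of_int_le_iff)
  then have "(\<Sum>x\<in>A. real (hamming_dist x (\<phi> x))) \<le> (\<Sum>x\<in>A. real_of_int (f x)) - (\<Sum>y\<in>B. real_of_int (f y))"
    by simp
  moreover have "real_of_int (f x) - real_of_int (f y) \<le> hamming_dist x y"
    if "x \<in> cube n" "y \<in> cube n" for x y
    using lip[OF that] by linarith
  ultimately show thesis using \<phi> that[of \<phi> "\<lambda>x. real_of_int (f x)"] by blast
qed

theorem theorem2:
  fixes n :: nat and A B :: "bool list set"
  assumes "n > 0"
    and "A \<subseteq> cube n" and "B \<subseteq> cube n"
    and "card A = 2 ^ (n - 1)" and "card B = 2 ^ (n - 1)"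
  shows "\<exists>\<phi>. bij_betw \<phi> A B \<and>
    measure_pmf.expectation (pmf_of_set A) (\<lambda>x. real (hamming_dist x (\<phi> x))) \<le> sqrt (2 * real n)"
proof -
  have ne: "A \<noteq> {}" "B \<noteq> {}" using assms(4,5) by auto
  have finA: "finite A" using assms(2) by (auto intro: finite_subset)
  have card: "card A = card B" using assms(4,5) by simp
  obtain \<phi> and f :: "bool list \<Rightarrow> real" where \<phi>: "bij_betw \<phi> A B"
    and lip: "\<And>x y. x \<in> cube n \<Longrightarrow> y \<in> cube n \<Longrightarrow> f x - f y \<le> hamming_dist x y"
    and le: "(\<Sum>x\<in>A. real (hamming_dist x (\<phi> x))) \<le> sum f A - sum f B"
    using hamming_bijection_lipschitz_potential[OF assms(2,3) card ne(2)] by blast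
  have "measure_pmf.expectation (pmf_of_set A) (\<lambda>x. real (hamming_dist x (\<phi> x)))
      = (\<Sum>x\<in>A. real (hamming_dist x (\<phi> x))) / 2 ^ (n - 1)"
    using integral_pmf_of_set[OF ne(1) finA] assms(4) by simp
  also have "\<dots> \<le> (2 ^ n * sqrt n / 2) / 2 ^ (n - 1)"
    using le lipschitz_cube_sum_diff[OF lip assms(2,3) card] by (intro divide_right_mono) auto
  \<comment> \<open>For positive \<open>n\<close>, \<open>2 ^ n / 2\<close> is exactly the size
    \<open>2 ^ (n - 1)\<close> of \<open>A\<close>, so averaging leaves
    \<open>sqrt n\<close>.\<close>
  also have "\<dots> = sqrt n"
    using \<open>n > 0\<close> by (cases n) auto
  also have "\<dots> \<le> sqrt (2 * real n)" by simp
  finally show ?thesis using \<phi> by blast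
qed

end
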